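(* Suppose the number of $n\ge1$ with $\Delta_{n-1}\Delta_n>0$ is finite and that both $\alpha_0'$ and $\beta_0'$ are imaginary (i.e. non-real). Let $N$ be a natural number such that $\Delta_{n-1}\Delta_n<0$ and $\Delta_{n-1}'\Delta_n'<0$ for all $n>N$ (such an $N$ exists). If $$\Delta_N\Delta_N'\,\Im(\alpha_0')\,\Im(\beta_0')<0,$$ where $\Im(z)$ denotes the imaginary part of a complex number $z$, then $$\lim_{n\to\infty}\left(\beta_n'+\frac{r_{n-2}}{r_{n-1}}\alpha_n'+\frac{r_{n-3}}{r_{n-1}}\right)=0.$$
   Context: For real $x$ let $[x]$ be the greatest integer $\le x$ and $\{x\}=x-[x]$. Let $\alpha_0,\beta_0$ be real algebraic irrational numbers with $0\le\alpha_0\le\beta_0$, $1\le\beta_0$, and assume $1,\alpha_0,\beta_0$ are linearly independent over $\mathbf{Q}$. The Jacobi-Perron algorithm (dimension 2) defines, for $n\ge1$, $\alpha_n=\{\beta_{n-1}\}/\{\alpha_{n-1}\}$ and $\beta_n=1/\{\alpha_{n-1}\}$ (all $\{\alpha_n\},\{\beta_n\}$ are nonzero). Put $a_n=[\alpha_n]$, $b_n=[\beta_n]$ for $n\ge0$. Define $(r_{-2},r_{-1},r_0)=(0,0,1)$, $(p_{-2},p_{-1},p_0)=(1,0,a_0)$, $(q_{-2},q_{-1},q_0)=(0,1,b_0)$, and for $n\ge1$: $r_n=r_{n-1}b_n+r_{n-2}a_n+r_{n-3}$, $p_n=p_{n-1}b_n+p_{n-2}a_n+p_{n-3}$, $q_n=q_{n-1}b_n+q_{n-2}a_n+q_{n-3}$.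 Set $\Delta_n=p_n-\alpha_0 r_n$ and $\Delta_n'=q_n-\beta_0 r_n$ for $n\ge0$ (here the prime on $\Delta_n'$ does not denote conjugation). Let $\alpha_0'\ne\alpha_0$ and $\beta_0'\ne\beta_0$ be algebraic conjugates of $\alpha_0$ and $\beta_0$, respectively. The numbers $\alpha_n',\beta_n'$ $(n\ge1)$ are defined successively by $\alpha_{n-1}'=a_{n-1}+\dfrac{1}{\beta_n'}$ and $\beta_{n-1}'=b_{n-1}+\dfrac{\alpha_n'}{\beta_n'}$, i.e. $\beta_n'=1/(\alpha_{n-1}'-a_{n-1})$ and $\alpha_n'=(\beta_{n-1}'-b_{n-1})/(\alpha_{n-1}'-a_{n-1})$; it is assumed that these are defined for all $n$ (no denominator $\alpha_{n-1}'-a_{n-1}$ vanishes). *)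

theory Defs
  imports "HOL-Analysis.Analysis" "HOL-Computational_Algebra.Computational_Algebra"
begin

text \<open>
  The complete quotients \<open>\<alpha>\<^sub>n\<close> and \<open>\<beta>\<^sub>n\<close> of the Jacobi-Perron algorithm started at \<open>(\<alpha>, \<beta>)\<close>.
\<close>

fun jp_alpha :: "real \<Rightarrow> real \<Rightarrow> nat \<Rightarrow> real"
  and jp_beta :: "real \<Rightarrow> real \<Rightarrow> nat \<Rightarrow> real" where
  "jp_alpha \<alpha> \<beta> 0 = \<alpha>"
| "jp_beta \<alpha> \<beta> 0 = \<beta>"
| "jp_alpha \<alpha> \<beta> (Suc n) = frac (jp_beta \<alpha> \<beta> n) / frac (jp_alpha \<alpha> \<beta> n)"
| "jp_beta \<alpha> \<beta> (Suc n) = 1 / frac (jp_alpha \<alpha> \<beta> n)"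

definition jp_a :: "real \<Rightarrow> real \<Rightarrow> nat \<Rightarrow> int" where
  "jp_a \<alpha> \<beta> n = \<lfloor>jp_alpha \<alpha> \<beta> n\<rfloor>"

definition jp_b :: "real \<Rightarrow> real \<Rightarrow> nat \<Rightarrow> int" where
  "jp_b \<alpha> \<beta> n = \<lfloor>jp_beta \<alpha> \<beta> n\<rfloor>"

text \<open>
  The solution of \<open>x\<^sub>n = x\<^sub>n\<^sub>-\<^sub>1 b\<^sub>n + x\<^sub>n\<^sub>-\<^sub>2 a\<^sub>n + x\<^sub>n\<^sub>-\<^sub>3\<close> for \<open>n \<ge> 1\<close> with \<open>(x\<^sub>-\<^sub>2, x\<^sub>-\<^sub>1, x\<^sub>0) = (u, v, w)\<close>.
  Since the indices start at \<open>-2\<close>, argument \<open>k\<close> of \<open>jp_rec\<close> stands for the index \<open>k - 2\<close>.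
\<close>

fun jp_rec :: "(nat \<Rightarrow> int) \<Rightarrow> (nat \<Rightarrow> int) \<Rightarrow> int \<Rightarrow> int \<Rightarrow> int \<Rightarrow> nat \<Rightarrow> int" where
  "jp_rec a b u v w 0 = u"
| "jp_rec a b u v w (Suc 0) = v"
| "jp_rec a b u v w (Suc (Suc 0)) = w"
| "jp_rec a b u v w (Suc (Suc (Suc k))) =
     jp_rec a b u v w (Suc (Suc k)) * b (Suc k) + jp_rec a b u v w (Suc k) * a (Suc k)
     + jp_rec a b u v w k"

text \<open>
  The following three sequences carry the original index \<open>n \<ge> -2\<close>;
  their values at \<open>n < -2\<close> are meaningless.
\<close>

definition jp_r :: "real \<Rightarrow> real \<Rightarrow> int \<Rightarrow> int" where
  "jp_r \<alpha> \<beta> n = jp_rec (jp_a \<alpha> \<beta>) (jp_b \<alpha> \<beta>) 0 0 1 (nat (n + 2))"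

definition jp_p :: "real \<Rightarrow> real \<Rightarrow> int \<Rightarrow> int" where
  "jp_p \<alpha> \<beta> n = jp_rec (jp_a \<alpha> \<beta>) (jp_b \<alpha> \<beta>) 1 0 (jp_a \<alpha> \<beta> 0) (nat (n + 2))"

definition jp_q :: "real \<Rightarrow> real \<Rightarrow> int \<Rightarrow> int" where
  "jp_q \<alpha> \<beta> n = jp_rec (jp_a \<alpha> \<beta>) (jp_b \<alpha> \<beta>) 0 1 (jp_b \<alpha> \<beta> 0) (nat (n + 2))"

definition jp_Delta :: "real \<Rightarrow> real \<Rightarrow> nat \<Rightarrow> real" where
  "jp_Delta \<alpha> \<beta> n = of_int (jp_p \<alpha> \<beta> (int n)) - \<alpha> * of_int (jp_r \<alpha> \<beta> (int n))"

definition jp_Delta' :: "real \<Rightarrow> real \<Rightarrow> nat \<Rightarrow> real" where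
  "jp_Delta' \<alpha> \<beta> n = of_int (jp_q \<alpha> \<beta> (int n)) - \<beta> * of_int (jp_r \<alpha> \<beta> (int n))"

text \<open>
  The sequences \<open>\<alpha>\<^sub>n'\<close> and \<open>\<beta>\<^sub>n'\<close> started at the complex numbers \<open>(\<alpha>', \<beta>')\<close>; the partial quotients
  subtracted are those of the real pair \<open>(\<alpha>, \<beta>)\<close>.
\<close>

fun jp_conj_alpha :: "real \<Rightarrow> real \<Rightarrow> complex \<Rightarrow> complex \<Rightarrow> nat \<Rightarrow> complex"
  and jp_conj_beta :: "real \<Rightarrow> real \<Rightarrow> complex \<Rightarrow> complex \<Rightarrow> nat \<Rightarrow> complex" where
  "jp_conj_alpha \<alpha> \<beta> \<alpha>' \<beta>' 0 = \<alpha>'"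
| "jp_conj_beta \<alpha> \<beta> \<alpha>' \<beta>' 0 = \<beta>'"
| "jp_conj_alpha \<alpha> \<beta> \<alpha>' \<beta>' (Suc n) =
     (jp_conj_beta \<alpha> \<beta> \<alpha>' \<beta>' n - of_int (jp_b \<alpha> \<beta> n)) /
     (jp_conj_alpha \<alpha> \<beta> \<alpha>' \<beta>' n - of_int (jp_a \<alpha> \<beta> n))"
| "jp_conj_beta \<alpha> \<beta> \<alpha>' \<beta>' (Suc n) =
     1 / (jp_conj_alpha \<alpha> \<beta> \<alpha>' \<beta>' n - of_int (jp_a \<alpha> \<beta> n))"

text \<open>
  Algebraic conjugates over the rationals: roots of a common irreducible rational polynomial,
  which is then, up to a constant factor, the minimal polynomial of both numbers.
\<close>

definition alg_conjugates :: "complex \<Rightarrow> complex \<Rightarrow> bool" where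
  "alg_conjugates x y \<longleftrightarrow>
     (\<exists>f :: rat poly. irreducible f \<and>
        poly (map_poly of_rat f) x = 0 \<and> poly (map_poly of_rat f) y = 0)"

end

theory Submission
  imports Defs
begin

text \<open>
  Write \<open>S\<^sub>n' = r\<^sub>n\<^sub>-\<^sub>1 \<beta>\<^sub>n' + r\<^sub>n\<^sub>-\<^sub>2 \<alpha>\<^sub>n' + r\<^sub>n\<^sub>-\<^sub>3\<close>, so that the claim is \<open>S\<^sub>n' / r\<^sub>n\<^sub>-\<^sub>1 \<rightarrow> 0\<close>; in fact \<open>S\<^sub>n'\<close> is
  bounded.  For any pair run through the expansion with the given partial quotients, real or
  conjugate, put \<open>D\<^sub>n = p\<^sub>n - \<alpha>\<^sub>0 r\<^sub>n\<close> and \<open>E\<^sub>n = q\<^sub>n - \<beta>\<^sub>0 r\<^sub>n\<close>.  The linear form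
  \<open>\<beta>\<^sub>n x\<^sub>n\<^sub>-\<^sub>1 + \<alpha>\<^sub>n x\<^sub>n\<^sub>-\<^sub>2 + x\<^sub>n\<^sub>-\<^sub>3\<close> is multiplied by \<open>\<beta>\<^sub>n\<^sub>+\<^sub>1\<close> at each step when \<open>x\<close> solves the
  recurrence.  On \<open>D\<close> and \<open>E\<close> it vanishes at the start, hence always, while on \<open>r\<close> it is the
  reciprocal, up to sign, of the Casoratian \<open>W\<^sub>n = D\<^sub>n\<^sub>-\<^sub>1 E\<^sub>n\<^sub>-\<^sub>2 - D\<^sub>n\<^sub>-\<^sub>2 E\<^sub>n\<^sub>-\<^sub>1\<close>, which is divided by \<open>\<beta>\<^sub>n\<^sub>+\<^sub>1\<close> at each step
  (\<open>form_times_casoratian\<close>).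

  For the real pair, \<open>W\<^sub>n < 0\<close> says that the slopes \<open>\<Delta>\<^sub>n' / \<Delta>\<^sub>n\<close> of the error vectors are strictly
  monotone as long as \<open>\<Delta>\<^sub>n\<close> alternates.  A monotone sequence without zeros has an eventually constant
  sign, so \<open>\<Delta>\<^sub>n'\<close> alternates eventually too (\<open>errE_eventually_alternating\<close>).

  For the conjugate pair, the errors are \<open>\<Delta>\<^sub>n + (\<alpha>\<^sub>0 - \<alpha>\<^sub>0') r\<^sub>n\<close> and \<open>\<Delta>\<^sub>n' + (\<beta>\<^sub>0 - \<beta>\<^sub>0') r\<^sub>n\<close>.  In the imaginary
  part of their Casoratian the quadratic term in the real errors disappears and four terms remain,
  which all have the same sign because both real errors alternate and
  \<open>\<Delta>\<^sub>N \<Delta>\<^sub>N' Im \<alpha>\<^sub>0' Im \<beta>\<^sub>0' < 0\<close>.  Hence \<open>|W\<^sub>n'|\<close> is at least a constant times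
  \<open>r\<^sub>n\<^sub>-\<^sub>1 (|\<Delta>\<^sub>n\<^sub>-\<^sub>2| + |\<Delta>\<^sub>n\<^sub>-\<^sub>2'|)\<close>.  The real identity \<open>S\<^sub>n\<^sub>-\<^sub>1 |W\<^sub>n\<^sub>-\<^sub>1| = 1\<close>, the bound
  \<open>S\<^sub>n\<^sub>-\<^sub>1 \<le> 3 r\<^sub>n\<^sub>-\<^sub>1\<close> and the boundedness of alternating errors show that this is bounded below
  (\<open>errors_lower_bound\<close>).  So \<open>S\<^sub>n' = -1 / W\<^sub>n'\<close> is bounded, and \<open>r\<^sub>n \<rightarrow> \<infinity>\<close> finishes the proof.
\<close>

section \<open>The linear form and the Casoratian of an expansion\<close>

text \<open>
  An expansion of a pair \<open>(A 0, B 0)\<close> along prescribed partial quotients.  Leaving the field and the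
  origin of the quotients open covers the real pair and the conjugate pair at once.  As in
  \<open>jp_rec\<close>, argument \<open>k\<close> of \<open>den\<close>, \<open>errD\<close> and \<open>errE\<close> stands for the index \<open>k - 2\<close>; argument \<open>n\<close> of
  \<open>form\<close> and \<open>casoratian\<close> stands for the complete quotients of index \<open>n + 1\<close>.
\<close>

locale jp_expansion =
  fixes a b :: "nat \<Rightarrow> int" and A B :: "nat \<Rightarrow> 'a::field"
  assumes A_neq: "A n - of_int (a n) \<noteq> 0"
    and A_Suc: "A (Suc n) = (B n - of_int (b n)) / (A n - of_int (a n))"
    and B_Suc: "B (Suc n) = 1 / (A n - of_int (a n))"
begin

definition den :: "nat \<Rightarrow> int" where
  "den = jp_rec a b 0 0 1"

definition errD :: "nat \<Rightarrow> 'a" where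
  "errD k = of_int (jp_rec a b 1 0 (a 0) k) - A 0 * of_int (den k)"

definition errE :: "nat \<Rightarrow> 'a" where
  "errE k = of_int (jp_rec a b 0 1 (b 0) k) - B 0 * of_int (den k)"

definition form :: "(nat \<Rightarrow> 'a) \<Rightarrow> nat \<Rightarrow> 'a" where
  "form x n = B (Suc n) * x (Suc (Suc n)) + A (Suc n) * x (Suc n) + x n"

definition casoratian :: "nat \<Rightarrow> 'a" where
  "casoratian n = errD (Suc (Suc n)) * errE (Suc n) - errD (Suc n) * errE (Suc (Suc n))"

text \<open>
  The quotients satisfy \<open>A n = a n + 1 / B (n + 1)\<close> and \<open>B n = b n + A (n + 1) / B (n + 1)\<close>; substituting
  them into the form at \<open>n\<close> and clearing the denominator gives the form at \<open>n + 1\<close>.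
\<close>

lemma form_Suc:
  assumes "\<And>k. x (Suc (Suc (Suc k))) =
    x (Suc (Suc k)) * of_int (b (Suc k)) + x (Suc k) * of_int (a (Suc k)) + x k"
  shows "form x (Suc n) = B (Suc (Suc n)) * form x n"
proof -
  have "B (Suc (Suc n)) * (A (Suc n) - of_int (a (Suc n))) = 1"
    using A_neq[of "Suc n"] by (simp add: B_Suc[of "Suc n"])
  then have A: "B (Suc (Suc n)) * A (Suc n) = B (Suc (Suc n)) * of_int (a (Suc n)) + 1"
    by (simp add: algebra_simps)
  have "A (Suc (Suc n)) = B (Suc (Suc n)) * (B (Suc n) - of_int (b (Suc n)))"
    by (simp add: A_Suc[of "Suc n"] B_Suc[of "Suc n"])
  then have B: "B (Suc (Suc n)) * B (Suc n) = B (Suc (Suc n)) * of_int (b (Suc n)) + A (Suc (Suc n))"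
    by (simp add: algebra_simps)
  have "B (Suc (Suc n)) * form x n = (B (Suc (Suc n)) * B (Suc n)) * x (Suc (Suc n))
      + (B (Suc (Suc n)) * A (Suc n)) * x (Suc n) + B (Suc (Suc n)) * x n"
    by (simp add: form_def algebra_simps)
  also have "\<dots> = form x (Suc n)"
    unfolding A B form_def assms by (simp add: algebra_simps)
  finally show ?thesis by simp
qed

lemma form_errD: "form errD n = 0"
proof (induction n)
  case 0
  show ?case
    using A_neq[of 0]
    by (simp add: form_def errD_def den_def B_Suc numeral_2_eq_2 field_simps)
next
  case (Suc n)
  have "form errD (Suc n) = B (Suc (Suc n)) * form errD n"
    by (rule form_Suc) (simp add: errD_def den_def algebra_simps)
  then show ?case using Suc by simp
qed

lemma form_errE: "form errE n = 0"
proof (induction n)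
  case 0
  show ?case
    using A_neq[of 0]
    by (simp add: form_def errE_def den_def B_Suc A_Suc numeral_2_eq_2 field_simps)
next
  case (Suc n)
  have "form errE (Suc n) = B (Suc (Suc n)) * form errE n"
    by (rule form_Suc) (simp add: errE_def den_def algebra_simps)
  then show ?case using Suc by simp
qed

text \<open>
  Eliminating the newest errors by \<open>form errD = 0\<close> and \<open>form errE = 0\<close> cancels the terms with \<open>A\<close>,
  the determinant being alternating; only the oldest errors survive, with swapped rows.
\<close>

lemma casoratian_Suc: "B (Suc (Suc n)) * casoratian (Suc n) = casoratian n"
proof -
  have D: "B (Suc (Suc n)) * errD (Suc (Suc (Suc n)))
      = - A (Suc (Suc n)) * errD (Suc (Suc n)) - errD (Suc n)"
    using form_errD[of "Suc n"] unfolding form_def by (simp add: eq_neg_iff_add_eq_0 algebra_simps)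
  have E: "B (Suc (Suc n)) * errE (Suc (Suc (Suc n)))
      = - A (Suc (Suc n)) * errE (Suc (Suc n)) - errE (Suc n)"
    using form_errE[of "Suc n"] unfolding form_def by (simp add: eq_neg_iff_add_eq_0 algebra_simps)
  have "B (Suc (Suc n)) * casoratian (Suc n)
      = (B (Suc (Suc n)) * errD (Suc (Suc (Suc n)))) * errE (Suc (Suc n))
        - errD (Suc (Suc n)) * (B (Suc (Suc n)) * errE (Suc (Suc (Suc n))))"
    by (simp add: casoratian_def algebra_simps)
  also have "\<dots> = casoratian n"
    unfolding D E casoratian_def by (simp add: algebra_simps)
  finally show ?thesis .
qed

lemma form_times_casoratian: "form (\<lambda>k. of_int (den k)) n * casoratian n = -1"
proof (induction n)
  case 0
  show ?case
    using A_neq[of 0]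
    by (simp add: form_def casoratian_def errD_def errE_def den_def B_Suc numeral_2_eq_2 field_simps)
next
  case (Suc n)
  have "form (\<lambda>k. of_int (den k)) (Suc n) = B (Suc (Suc n)) * form (\<lambda>k. of_int (den k)) n"
    by (rule form_Suc) (simp add: den_def)
  then have "form (\<lambda>k. of_int (den k)) (Suc n) * casoratian (Suc n)
      = form (\<lambda>k. of_int (den k)) n * (B (Suc (Suc n)) * casoratian (Suc n))"
    by (simp only: mult_ac)
  then show ?case
    by (simp only: casoratian_Suc Suc.IH)
qed

end

section \<open>The real expansion\<close>

locale jp_real_expansion = jp_expansion a b A B
  for a b :: "nat \<Rightarrow> int" and A B :: "nat \<Rightarrow> real" +
  assumes A_less_B: "A (Suc n) < B (Suc n)"
    and A_pos: "0 < A (Suc n)"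
    and B_gt_1: "1 < B (Suc n)"
    and a_floor: "a n = \<lfloor>A n\<rfloor>"
    and b_floor: "b n = \<lfloor>B n\<rfloor>"
begin

lemma a_nonneg: "0 \<le> a (Suc n)"
  using A_pos[of n] by (simp add: a_floor)

lemma b_ge_1: "1 \<le> b (Suc n)"
  using B_gt_1[of n] by (simp add: b_floor le_floor_iff)

lemma den_rec:
  "den (Suc (Suc (Suc k))) = den (Suc (Suc k)) * b (Suc k) + den (Suc k) * a (Suc k) + den k"
  by (simp add: den_def)

lemma den_nonneg_mono: "0 \<le> den k \<and> den k \<le> den (Suc k)"
proof (induction k rule: less_induct)
  case (less k)
  consider "k = 0" | "k = 1" | m where "k = Suc (Suc m)"
    by (metis One_nat_def not0_implies_Suc)
  then show ?case
  proof cases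
    case (3 m)
    have *: "0 \<le> den m" "0 \<le> den (Suc m)" "0 \<le> den (Suc (Suc m))"
      using less[of m] less[of "Suc m"] 3 by auto
    have "den (Suc (Suc m)) * 1 \<le> den (Suc (Suc m)) * b (Suc m)"
      by (rule mult_left_mono) (use b_ge_1 * in auto)
    moreover have "0 \<le> den (Suc m) * a (Suc m)"
      using * a_nonneg by simp
    ultimately show ?thesis
      using * 3 den_rec[of m] by simp
  qed (simp_all add: den_def numeral_2_eq_2)
qed

lemma den_nonneg: "0 \<le> den k"
  using den_nonneg_mono by blast

lemma den_mono: "mono den"
  using den_nonneg_mono by (simp add: mono_iff_le_Suc)

lemma den_pos: "0 < den (Suc (Suc k))"
proof -
  have "den (Suc (Suc 0)) \<le> den (Suc (Suc k))"
    using den_mono by (rule monoD) simp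
  then show ?thesis by (simp add: den_def)
qed

text \<open>
  The term \<open>den k\<close> in the recurrence makes the denominators grow at least linearly, by one in each
  step once they are positive.
\<close>

lemma den_ge_linear: "int k \<le> den (k + 4)"
proof (induction k)
  case 0
  show ?case using den_nonneg by simp
next
  case (Suc k)
  have eq: "den (Suc k + 4) = den (k + 4) * b (k + 3) + den (k + 3) * a (k + 3) + den (Suc (Suc k))"
    using den_rec[of "k + 2"] by (simp add: numeral_eq_Suc)
  have "den (k + 4) * 1 \<le> den (k + 4) * b (k + 3)"
    by (rule mult_left_mono) (use b_ge_1[of "k + 2"] den_nonneg in \<open>auto simp: numeral_eq_Suc\<close>)
  moreover have "0 \<le> den (k + 3) * a (k + 3)"
    using den_nonneg a_nonneg[of "k + 2"] by (simp add: numeral_eq_Suc)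
  moreover have "1 \<le> den (Suc (Suc k))"
    using den_pos[of k] by simp
  ultimately show ?case
    using Suc eq by linarith
qed

lemma filterlim_den: "filterlim (\<lambda>n. real_of_int (den (Suc (Suc n)))) at_top sequentially"
proof (rule filterlim_at_top_mono)
  show "filterlim (\<lambda>n. real n - 2) at_top sequentially"
    using filterlim_tendsto_add_at_top[OF tendsto_const[of "-2 :: real"] filterlim_real_sequentially]
    by simp
  show "\<forall>\<^sub>F n in sequentially. real n - 2 \<le> real_of_int (den (Suc (Suc n)))"
  proof (rule eventually_sequentiallyI)
    fix n :: nat assume "2 \<le> n"
    then obtain k where "n = k + 2" by (metis le_add_diff_inverse2)
    then show "real n - 2 \<le> real_of_int (den (Suc (Suc n)))"
      using den_ge_linear[of k] by (simp add: numeral_eq_Suc)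
  qed
qed

lemma form_den_pos: "0 < form (\<lambda>k. of_int (den k)) n"
proof -
  have "0 < B (Suc n) * of_int (den (Suc (Suc n)))"
    using B_gt_1[of n] den_pos[of n] by simp
  moreover have "0 \<le> A (Suc n) * of_int (den (Suc n))"
    using A_pos[of n] den_nonneg[of "Suc n"] by simp
  ultimately show ?thesis
    using den_nonneg[of n] unfolding form_def by (smt (verit) of_int_0_le_iff)
qed

text \<open>
  The form arises from \<open>den (n + 3)\<close> by putting the complete quotients in place of their floors; as
  \<open>b (n + 1) \<ge> 1\<close>, each of the two replacements adds at most \<open>b (n + 1) * den (n + 2)\<close>.
\<close>

lemma form_den_le: "form (\<lambda>k. of_int (den k)) n \<le> 3 * of_int (den (Suc (Suc (Suc n))))"
proof -
  define r0 r1 r2 where "r0 = real_of_int (den n)" and "r1 = real_of_int (den (Suc n))"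
    and "r2 = real_of_int (den (Suc (Suc n)))"
  define u v where "u = real_of_int (a (Suc n))" and "v = real_of_int (b (Suc n))"
  have r: "0 \<le> r0" "0 \<le> r1" "r1 \<le> r2" "0 \<le> r2"
    unfolding r0_def r1_def r2_def using den_nonneg den_nonneg_mono by auto
  have u: "0 \<le> u" and v: "1 \<le> v"
    unfolding u_def v_def using a_nonneg b_ge_1 by auto
  have Au: "A (Suc n) \<le> u + 1" and Bv: "B (Suc n) \<le> v + 1"
    unfolding u_def v_def a_floor b_floor by linarith+
  have "B (Suc n) * r2 \<le> (v + 1) * r2" "A (Suc n) * r1 \<le> (u + 1) * r1"
    using Au Bv r by (auto intro: mult_right_mono)
  moreover have "1 * r2 \<le> v * r2"
    using v r by (intro mult_right_mono) auto
  moreover have "0 \<le> u * r1" using u r by simp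
  moreover have "real_of_int (den (Suc (Suc (Suc n)))) = r2 * v + r1 * u + r0"
    unfolding r0_def r1_def r2_def u_def v_def by (simp add: den_rec)
  ultimately show ?thesis
    using r unfolding form_def r0_def[symmetric] r1_def[symmetric] r2_def[symmetric]
    by (simp add: algebra_simps)
qed

lemma casoratian_neg: "casoratian n < 0"
proof -
  have "form (\<lambda>k. of_int (den k)) n * casoratian n < 0"
    by (simp add: form_times_casoratian)
  then show ?thesis
    using form_den_pos[of n] by (simp add: mult_less_0_iff)
qed

section \<open>Alternating errors\<close>

text \<open>
  In \<open>form x k = 0\<close> the outer terms have the sign opposite to the middle one, so the newest term alone
  is at most the middle one, and \<open>A \<le> B\<close> removes the coefficients.
\<close>

lemma alternating_bounded:
  assumes form: "\<And>n. form x n = 0"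
    and alt: "\<And>k. k0 \<le> k \<Longrightarrow> x k * x (Suc k) < 0"
    and "Suc k0 \<le> k"
  shows "\<bar>x k\<bar> \<le> \<bar>x (Suc k0)\<bar>"
  using \<open>Suc k0 \<le> k\<close>
proof (induction k rule: dec_induct)
  case (step k)
  then obtain m where k: "k = Suc m" and m: "k0 \<le> m"
    by (metis Suc_le_D Suc_le_mono)
  have f: "B k * x (Suc k) + A k * x k + x m = 0"
    using form[of m] by (simp add: form_def k)
  have pos: "0 < A k" "A k < B k"
    using A_pos A_less_B by (simp_all add: k)
  have "\<bar>B k * x (Suc k)\<bar> \<le> \<bar>A k * x k\<bar>"
  proof (cases "0 < x m")
    case True
    then have "x k < 0" "0 < x (Suc k)"
      using alt[of m] alt[of k] m by (auto simp: k mult_less_0_iff)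
    moreover have "0 < B k * x (Suc k)" "A k * x k < 0"
      using calculation pos by (simp_all add: mult_less_0_iff)
    ultimately show ?thesis using f True by linarith
  next
    case False
    then have "x m < 0" "0 < x k" "x (Suc k) < 0"
      using alt[of m] alt[of k] m by (auto simp: k mult_less_0_iff)
    moreover have "B k * x (Suc k) < 0" "0 < A k * x k"
      using calculation pos by (simp_all add: mult_less_0_iff)
    ultimately show ?thesis using f by linarith
  qed
  also have "\<bar>A k * x k\<bar> \<le> B k * \<bar>x k\<bar>"
    using pos by (auto simp: abs_mult intro: mult_right_mono)
  finally have "\<bar>x (Suc k)\<bar> \<le> \<bar>x k\<bar>"
    using pos by (simp add: abs_mult)
  then show ?case using step.IH by linarith
qed simp

text \<open>
  The difference of consecutive slopes \<open>errE / errD\<close> is the Casoratian divided by a product of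
  consecutive values of \<open>errD\<close>; both are negative, so the slopes decrease strictly and their sign
  changes at most once.
\<close>

lemma errE_eventually_alternating:
  assumes alt: "\<And>k. k0 \<le> k \<Longrightarrow> errD k * errD (Suc k) < 0"
    and nz: "\<And>k. k0 \<le> k \<Longrightarrow> errE k \<noteq> 0"
  shows "\<exists>k1. \<forall>k\<ge>k1. errE k * errE (Suc k) < 0"
proof -
  define t where "t k = errE (k + Suc k0) / errD (k + Suc k0)" for k
  have t_dec: "t (Suc k) < t k" for k
  proof -
    define m where "m = k + k0"
    have D: "errD (Suc m) * errD (Suc (Suc m)) < 0"
      using alt[of "Suc m"] by (simp add: m_def)
    then have "errD (Suc m) \<noteq> 0" "errD (Suc (Suc m)) \<noteq> 0" by auto
    then have "t k - t (Suc k) = casoratian m / (errD (Suc m) * errD (Suc (Suc m)))"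
      by (simp add: t_def casoratian_def m_def field_simps)
    also have "\<dots> > 0"
      using D casoratian_neg by (simp add: divide_neg_neg)
    finally show ?thesis by simp
  qed
  then have "decseq t"
    unfolding decseq_Suc_iff by (blast intro: less_imp_le)
  then have dec: "t l \<le> t k" if "k \<le> l" for k l
    using that by (rule decseqD)
  have t_nz: "t k \<noteq> 0" for k
    using nz[of "k + Suc k0"] alt[of "k + Suc k0"] by (auto simp: t_def)
  have "\<exists>k1. \<forall>k\<ge>k1. 0 < t k * t (Suc k)"
  proof (cases "\<forall>k. 0 < t k")
    case True
    then show ?thesis by (auto intro: mult_pos_pos)
  next
    case False
    then obtain k1 where "t k1 < 0" using t_nz by (metis linorder_neqE)
    then have "t k < 0" if "k1 \<le> k" for k using dec[OF that] by linarith
    then show ?thesis by (meson le_SucI mult_neg_neg)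
  qed
  then obtain k1 where k1: "\<And>k. k1 \<le> k \<Longrightarrow> 0 < t k * t (Suc k)" by blast
  have "errE k * errE (Suc k) < 0" if "k1 + Suc k0 \<le> k" for k
  proof -
    obtain j where k: "k = j + Suc k0" and j: "k1 \<le> j"
      by (rule that[of "k - Suc k0"]) (use \<open>k1 + Suc k0 \<le> k\<close> in simp_all)
    have D: "errD k * errD (Suc k) < 0"
      using alt[of k] by (simp add: k)
    then have "errE k * errE (Suc k) = (t j * t (Suc j)) * (errD k * errD (Suc k))"
      by (auto simp: t_def k)
    also have "\<dots> < 0"
      using k1[OF j] D by (rule mult_pos_neg)
    finally show ?thesis .
  qed
  then show ?thesis by blast
qed

text \<open>
  The vectors \<open>(errD, errE)\<close> of indices \<open>m\<close> and \<open>m + 1\<close> span a parallelogram of area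
  \<open>\<bar>casoratian (m - 1)\<bar>\<close>, the reciprocal of the form of the denominators, which is at least \<open>1 / (3 * den (m + 2))\<close>.  As the first vector is bounded, the second one cannot be
  shorter than a constant times \<open>1 / den (m + 2)\<close>.
\<close>

lemma errors_lower_bound:
  assumes "\<bar>errD (Suc n)\<bar> \<le> K" and "\<bar>errE (Suc n)\<bar> \<le> K"
  shows "1 \<le> 3 * K * of_int (den (Suc (Suc (Suc n))))
           * (\<bar>errD (Suc (Suc n))\<bar> + \<bar>errE (Suc (Suc n))\<bar>)"
proof -
  let ?D = "\<bar>errD (Suc (Suc n))\<bar>" and ?E = "\<bar>errE (Suc (Suc n))\<bar>"
  have "1 = form (\<lambda>k. of_int (den k)) n * \<bar>casoratian n\<bar>"
    using form_times_casoratian[of n] casoratian_neg[of n] by simp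
  also have "\<dots> \<le> (3 * of_int (den (Suc (Suc (Suc n))))) * (K * (?D + ?E))"
  proof (rule mult_mono)
    have "\<bar>casoratian n\<bar> \<le> ?D * \<bar>errE (Suc n)\<bar> + \<bar>errD (Suc n)\<bar> * ?E"
      unfolding casoratian_def by (metis abs_mult abs_triangle_ineq4)
    also have "\<dots> \<le> ?D * K + K * ?E"
      using assms by (intro add_mono mult_left_mono mult_right_mono) auto
    finally show "\<bar>casoratian n\<bar> \<le> K * (?D + ?E)" by (simp add: algebra_simps)
    show "form (\<lambda>k. of_int (den k)) n \<le> 3 * of_int (den (Suc (Suc (Suc n))))"
      by (rule form_den_le)
    show "0 \<le> 3 * real_of_int (den (Suc (Suc (Suc n))))"
      using den_nonneg by simp
  qed simp
  finally show ?thesis by (simp add: algebra_simps)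
qed

end

section \<open>The Jacobi-Perron expansion of a rationally independent pair\<close>

text \<open>
  Multiplying a relation between \<open>1\<close>, \<open>\<alpha>\<^sub>n\<^sub>+\<^sub>1\<close>, \<open>\<beta>\<^sub>n\<^sub>+\<^sub>1\<close> by the fractional part of \<open>\<alpha>\<^sub>n\<close> gives one
  between \<open>1\<close>, \<open>\<alpha>\<^sub>n\<close>, \<open>\<beta>\<^sub>n\<close>.  Independence keeps all fractional parts nonzero, so no division by zero
  distorts the algorithm.
\<close>

lemma jp_complete_quotients_independent:
  fixes \<alpha> \<beta> :: real
  assumes "\<And>x y z :: rat. of_rat x + of_rat y * \<alpha> + of_rat z * \<beta> = 0 \<Longrightarrow> x = 0 \<and> y = 0 \<and> z = 0"
  shows "of_rat x + of_rat y * jp_alpha \<alpha> \<beta> n + of_rat z * jp_beta \<alpha> \<beta> n = 0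
         \<Longrightarrow> x = 0 \<and> y = 0 \<and> z = 0"
proof (induction n arbitrary: x y z)
  case 0
  then show ?case using assms by simp
next
  case (Suc n)
  let ?A = "jp_alpha \<alpha> \<beta> n" and ?B = "jp_beta \<alpha> \<beta> n"
  have "frac ?A \<noteq> 0"
  proof
    assume "frac ?A = 0"
    then have "?A = of_int \<lfloor>?A\<rfloor>" by (simp add: frac_def)
    then have "of_rat (- of_int \<lfloor>?A\<rfloor>) + of_rat 1 * ?A + of_rat 0 * ?B = 0"
      by (simp add: of_rat_minus)
    then show False using Suc.IH[of "- of_int \<lfloor>?A\<rfloor>" 1 0] by simp
  qed
  then have "of_rat x * frac ?A + of_rat y * frac ?B + of_rat z = 0"
    using Suc.prems by (simp add: field_simps)
  then have "of_rat (z - x * of_int \<lfloor>?A\<rfloor> - y * of_int \<lfloor>?B\<rfloor>) + of_rat x * ?A + of_rat y * ?B = 0"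
    by (simp add: frac_def of_rat_diff of_rat_mult right_diff_distrib left_diff_distrib)
  from Suc.IH[OF this] show ?case by auto
qed

lemma jp_frac_pos:
  fixes \<alpha> \<beta> :: real
  assumes "\<And>x y z :: rat. of_rat x + of_rat y * \<alpha> + of_rat z * \<beta> = 0 \<Longrightarrow> x = 0 \<and> y = 0 \<and> z = 0"
  shows "0 < frac (jp_alpha \<alpha> \<beta> n)" and "0 < frac (jp_beta \<alpha> \<beta> n)"
proof -
  let ?A = "jp_alpha \<alpha> \<beta> n" and ?B = "jp_beta \<alpha> \<beta> n"
  have "?A \<noteq> of_int \<lfloor>?A\<rfloor>"
  proof
    assume "?A = of_int \<lfloor>?A\<rfloor>"
    then have "of_rat (- of_int \<lfloor>?A\<rfloor>) + of_rat 1 * ?A + of_rat 0 * ?B = 0"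
      by (simp add: of_rat_minus)
    from jp_complete_quotients_independent[OF assms this] show False by simp
  qed
  then show "0 < frac ?A"
    using frac_ge_0[of ?A] unfolding frac_def by linarith
  have "?B \<noteq> of_int \<lfloor>?B\<rfloor>"
  proof
    assume "?B = of_int \<lfloor>?B\<rfloor>"
    then have "of_rat (- of_int \<lfloor>?B\<rfloor>) + of_rat 0 * ?A + of_rat 1 * ?B = 0"
      by (simp add: of_rat_minus)
    from jp_complete_quotients_independent[OF assms this] show False by simp
  qed
  then show "0 < frac ?B"
    using frac_ge_0[of ?B] unfolding frac_def by linarith
qed

lemma jp_real_expansion_jp:
  fixes \<alpha> \<beta> :: real
  assumes ind: "\<And>x y z :: rat. of_rat x + of_rat y * \<alpha> + of_rat z * \<beta> = 0
                  \<Longrightarrow> x = 0 \<and> y = 0 \<and> z = 0"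
  shows "jp_real_expansion (jp_a \<alpha> \<beta>) (jp_b \<alpha> \<beta>) (jp_alpha \<alpha> \<beta>) (jp_beta \<alpha> \<beta>)"
proof
  fix n
  note pos = jp_frac_pos[OF ind]
  have A: "0 < frac (jp_alpha \<alpha> \<beta> n)" by (rule pos)
  have B: "0 < frac (jp_beta \<alpha> \<beta> n)" by (rule pos)
  show "jp_alpha \<alpha> \<beta> n - of_int (jp_a \<alpha> \<beta> n) \<noteq> 0"
    using A by (simp add: frac_def jp_a_def)
  show "jp_alpha \<alpha> \<beta> (Suc n)
      = (jp_beta \<alpha> \<beta> n - of_int (jp_b \<alpha> \<beta> n)) / (jp_alpha \<alpha> \<beta> n - of_int (jp_a \<alpha> \<beta> n))"
    by (simp add: frac_def jp_a_def jp_b_def)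
  show "jp_beta \<alpha> \<beta> (Suc n) = 1 / (jp_alpha \<alpha> \<beta> n - of_int (jp_a \<alpha> \<beta> n))"
    by (simp add: frac_def jp_a_def)
  show "jp_alpha \<alpha> \<beta> (Suc n) < jp_beta \<alpha> \<beta> (Suc n)"
    using A frac_lt_1[of "jp_beta \<alpha> \<beta> n"] by (simp add: divide_strict_right_mono)
  show "0 < jp_alpha \<alpha> \<beta> (Suc n)"
    using A B by simp
  show "1 < jp_beta \<alpha> \<beta> (Suc n)"
    using A frac_lt_1[of "jp_alpha \<alpha> \<beta> n"] by simp
qed (simp_all add: jp_a_def jp_b_def)

section \<open>The conjugate expansion\<close>

lemma same_sign_combination_abs_ge:
  fixes p q x x' y y' :: real
  assumes "0 \<le> p" "0 \<le> q" and "0 \<le> x * x'" "0 \<le> y * y'" and "0 < x * y"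
  shows "p * (\<bar>x\<bar> + \<bar>y\<bar>) \<le> \<bar>p * x + q * x' + p * y + q * y'\<bar>"
proof (cases "0 < x")
  case True
  then have s: "0 < y" "0 \<le> x'" "0 \<le> y'"
    using assms by (auto simp: zero_less_mult_iff zero_le_mult_iff)
  then have "0 \<le> p * x" "0 \<le> p * y" "0 \<le> q * x'" "0 \<le> q * y'"
    using assms True by auto
  then show ?thesis using True s by (simp add: algebra_simps)
next
  case False
  then have s: "x < 0" "y < 0" "x' \<le> 0" "y' \<le> 0"
    using assms by (auto simp: zero_less_mult_iff zero_le_mult_iff)
  then have "p * x \<le> 0" "p * y \<le> 0" "q * x' \<le> 0" "q * y' \<le> 0"
    using assms by (auto simp: mult_nonneg_nonpos)
  then show ?thesis using s by (simp add: algebra_simps)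
qed

lemma alternating_product_sign:
  fixes x y :: "nat \<Rightarrow> real"
  assumes x: "\<And>k. k0 \<le> k \<Longrightarrow> x k * x (Suc k) < 0"
    and y: "\<And>k. k0 \<le> k \<Longrightarrow> y k * y (Suc k) < 0"
    and "x k0 * y k0 * c < 0" and "k0 \<le> k"
  shows "x k * y k * c < 0"
  using \<open>k0 \<le> k\<close>
proof (induction k rule: dec_induct)
  case base
  show ?case by fact
next
  case (step k)
  have "0 < (x k * x (Suc k)) * (y k * y (Suc k))"
    using x[of k] y[of k] step.hyps by (simp add: mult_neg_neg)
  then have "0 < (x k * y k) * (x (Suc k) * y (Suc k))"
    by (simp add: mult_ac)
  then show ?case using step.IH
    by (auto simp: zero_less_mult_iff mult_less_0_iff)
qed

text \<open>
  The conjugate errors differ from the real ones by complex multiples of \<open>den\<close>, with imaginary factors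
  \<open>- Im (A' 0)\<close> and \<open>- Im (B' 0)\<close>.  The part of the Casoratian quadratic in the real errors is real and
  the part quadratic in \<open>den\<close> cancels, so its imaginary part is linear in the real errors with
  nonnegative denominators as weights.  Alternation makes the two terms with \<open>errE\<close> agree in sign,
  and those with \<open>errD\<close>; the sign hypothesis makes the two groups agree.  Without cancellation, the
  imaginary part inherits the lower bound for the real errors.
\<close>

lemma conjugate_form_bounded:
  fixes A' B' :: "nat \<Rightarrow> complex"
  assumes "jp_real_expansion a b A B" and "jp_expansion a b A' B'"
    and alt_D: "\<And>k. k0 \<le> k \<Longrightarrow> jp_expansion.errD a b A k * jp_expansion.errD a b A (Suc k) < 0"
    and alt_E: "\<And>k. k0 \<le> k \<Longrightarrow> jp_expansion.errE a b B k * jp_expansion.errE a b B (Suc k) < 0"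
    and sign: "jp_expansion.errD a b A k0 * jp_expansion.errE a b B k0 * (Im (A' 0) * Im (B' 0)) < 0"
  shows "\<exists>M. \<forall>n\<ge>k0 + 2. norm (jp_expansion.form A' B'
           (\<lambda>k. of_int (jp_expansion.den a b k)) n) \<le> M"
proof -
  interpret R: jp_real_expansion a b A B by fact
  interpret C: jp_expansion a b A' B' by fact
  define \<kappa> where "\<kappa> = min \<bar>Im (A' 0)\<bar> \<bar>Im (B' 0)\<bar>"
  have \<kappa>: "0 < \<kappa>" using sign by (auto simp: \<kappa>_def)
  define K where "K = max \<bar>R.errD (Suc k0)\<bar> \<bar>R.errE (Suc k0)\<bar>"
  have "R.errD (Suc k0) \<noteq> 0" using alt_D[of k0] by auto
  then have K: "0 < K" by (simp add: K_def less_max_iff_disj)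
  have K_D: "\<bar>R.errD k\<bar> \<le> K" if "Suc k0 \<le> k" for k
    using R.alternating_bounded[where x = R.errD and ?k0.0 = k0, OF R.form_errD alt_D that] by (simp add: K_def)
  have K_E: "\<bar>R.errE k\<bar> \<le> K" if "Suc k0 \<le> k" for k
    using R.alternating_bounded[where x = R.errE and ?k0.0 = k0, OF R.form_errE alt_E that] by (simp add: K_def)
  have "norm (C.form (\<lambda>k. of_int (R.den k)) n) \<le> 3 * K / \<kappa>" if n: "k0 + 2 \<le> n" for n
  proof -
    obtain m where m: "n = Suc m" "Suc k0 \<le> m"
      using n by (metis Suc_le_D Suc_le_mono add_2_eq_Suc')
    let ?r = "real_of_int (R.den (Suc n))" and ?s = "real_of_int (R.den (Suc (Suc n)))"
    let ?D = "R.errD (Suc n)" and ?E = "R.errE (Suc n)"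
    have D_conj: "Im (C.errD k) = - Im (A' 0) * of_int (R.den k)"
      "Re (C.errD k) = R.errD k + (A 0 - Re (A' 0)) * of_int (R.den k)" for k
      by (simp_all add: C.errD_def R.errD_def algebra_simps)
    have E_conj: "Im (C.errE k) = - Im (B' 0) * of_int (R.den k)"
      "Re (C.errE k) = R.errE k + (B 0 - Re (B' 0)) * of_int (R.den k)" for k
      by (simp_all add: C.errE_def R.errE_def algebra_simps)
    have Im_eq: "Im (C.casoratian n)
        = ?s * (- Im (A' 0) * ?E) + ?r * (Im (A' 0) * R.errE (Suc (Suc n)))
          + ?s * (Im (B' 0) * ?D) + ?r * (- Im (B' 0) * R.errD (Suc (Suc n)))"
      by (simp add: C.casoratian_def D_conj E_conj algebra_simps)
    have "R.errD (Suc n) * R.errE (Suc n) * (Im (A' 0) * Im (B' 0)) < 0"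
      using alternating_product_sign[of k0 R.errD R.errE, OF alt_D alt_E sign] m by simp
    then have xy: "0 < (- Im (A' 0) * ?E) * (Im (B' 0) * ?D)"
      by (simp add: algebra_simps)
    have EE: "0 \<le> (- Im (A' 0) * ?E) * (Im (A' 0) * R.errE (Suc (Suc n)))"
    proof -
      have "(- Im (A' 0) * ?E) * (Im (A' 0) * R.errE (Suc (Suc n)))
          = (Im (A' 0))\<^sup>2 * - (?E * R.errE (Suc (Suc n)))"
        by (simp add: power2_eq_square algebra_simps)
      also have "\<dots> \<ge> 0"
        using alt_E[of "Suc n"] m by (intro mult_nonneg_nonneg) auto
      finally show ?thesis .
    qed
    have DD: "0 \<le> (Im (B' 0) * ?D) * (- Im (B' 0) * R.errD (Suc (Suc n)))"
    proof -
      have "(Im (B' 0) * ?D) * (- Im (B' 0) * R.errD (Suc (Suc n)))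
          = (Im (B' 0))\<^sup>2 * - (?D * R.errD (Suc (Suc n)))"
        by (simp add: power2_eq_square algebra_simps)
      also have "\<dots> \<ge> 0"
        using alt_D[of "Suc n"] m by (intro mult_nonneg_nonneg) auto
      finally show ?thesis .
    qed
    have "\<kappa> / (3 * K) \<le> \<kappa> * (?s * (\<bar>?D\<bar> + \<bar>?E\<bar>))"
    proof -
      have "1 \<le> 3 * K * ?s * (\<bar>?D\<bar> + \<bar>?E\<bar>)"
        using R.errors_lower_bound[OF K_D K_E, of m] m(2) unfolding m(1) by simp
      then have "\<kappa> * 1 \<le> \<kappa> * (3 * K * ?s * (\<bar>?D\<bar> + \<bar>?E\<bar>))"
        using \<kappa> by (intro mult_left_mono) auto
      then show ?thesis
        using K by (simp add: divide_le_eq ac_simps)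
    qed
    also have "\<dots> = ?s * (\<kappa> * \<bar>?E\<bar> + \<kappa> * \<bar>?D\<bar>)"
      by (simp add: distrib_left ac_simps)
    also have "\<dots> \<le> ?s * (\<bar>- Im (A' 0) * ?E\<bar> + \<bar>Im (B' 0) * ?D\<bar>)"
    proof (intro mult_left_mono add_mono)
      show "\<kappa> * \<bar>?E\<bar> \<le> \<bar>- Im (A' 0) * ?E\<bar>"
        by (simp add: abs_mult \<kappa>_def mult_right_mono)
      show "\<kappa> * \<bar>?D\<bar> \<le> \<bar>Im (B' 0) * ?D\<bar>"
        by (simp add: abs_mult \<kappa>_def mult_right_mono)
      show "0 \<le> ?s" using R.den_nonneg by simp
    qed
    also have "\<dots> \<le> \<bar>Im (C.casoratian n)\<bar>"
      unfolding Im_eq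
      using R.den_nonneg by (intro same_sign_combination_abs_ge EE DD xy) simp_all
    also have "\<dots> \<le> norm (C.casoratian n)"
      by (rule abs_Im_le_cmod)
    finally have W: "\<kappa> / (3 * K) \<le> norm (C.casoratian n)" .
    have "norm (C.form (\<lambda>k. of_int (R.den k)) n) * norm (C.casoratian n) = 1"
      using C.form_times_casoratian[of n] by (metis norm_minus_cancel norm_mult norm_one)
    then have "norm (C.form (\<lambda>k. of_int (R.den k)) n) * (\<kappa> / (3 * K)) \<le> 1"
      using mult_left_mono[OF W, of "norm (C.form (\<lambda>k. of_int (R.den k)) n)"] by simp
    then show ?thesis
      using \<kappa> K by (simp add: field_simps)
  qed
  then show ?thesis by blast
qed

section \<open>The limit\<close>

theorem theorem3p2:
  fixes \<alpha> \<beta> :: real and \<alpha>' \<beta>' :: complex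
  assumes "algebraic \<alpha>" and "algebraic \<beta>"
    and "\<alpha> \<notin> \<rat>" and "\<beta> \<notin> \<rat>"
    and "0 \<le> \<alpha>" and "\<alpha> \<le> \<beta>" and "1 \<le> \<beta>"
    and lin_indep: "\<And>x y z :: rat. of_rat x + of_rat y * \<alpha> + of_rat z * \<beta> = 0
                      \<Longrightarrow> x = 0 \<and> y = 0 \<and> z = 0"
    and "alg_conjugates (complex_of_real \<alpha>) \<alpha>'" and "\<alpha>' \<noteq> complex_of_real \<alpha>"
    and "alg_conjugates (complex_of_real \<beta>) \<beta>'" and "\<beta>' \<noteq> complex_of_real \<beta>"
    and defined: "\<And>n. jp_conj_alpha \<alpha> \<beta> \<alpha>' \<beta>' n - of_int (jp_a \<alpha> \<beta> n) \<noteq> 0"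
    and "finite {n. n \<ge> 1 \<and> jp_Delta \<alpha> \<beta> (n - 1) * jp_Delta \<alpha> \<beta> n > 0}"
    and "\<alpha>' \<notin> \<real>" and "\<beta>' \<notin> \<real>"
  shows "(\<exists>N. \<forall>n>N. jp_Delta \<alpha> \<beta> (n - 1) * jp_Delta \<alpha> \<beta> n < 0 \<and>
                     jp_Delta' \<alpha> \<beta> (n - 1) * jp_Delta' \<alpha> \<beta> n < 0)
       \<and> (\<forall>N. (\<forall>n>N. jp_Delta \<alpha> \<beta> (n - 1) * jp_Delta \<alpha> \<beta> n < 0 \<and>
                      jp_Delta' \<alpha> \<beta> (n - 1) * jp_Delta' \<alpha> \<beta> n < 0)
            \<longrightarrow> jp_Delta \<alpha> \<beta> N * jp_Delta' \<alpha> \<beta> N * Im \<alpha>' * Im \<beta>' < 0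
            \<longrightarrow> (\<lambda>n. jp_conj_beta \<alpha> \<beta> \<alpha>' \<beta>' n
                     + of_int (jp_r \<alpha> \<beta> (int n - 2)) / of_int (jp_r \<alpha> \<beta> (int n - 1))
                         * jp_conj_alpha \<alpha> \<beta> \<alpha>' \<beta>' n
                     + of_int (jp_r \<alpha> \<beta> (int n - 3)) / of_int (jp_r \<alpha> \<beta> (int n - 1)))
                \<longlonglongrightarrow> 0)"
proof -
  interpret R: jp_real_expansion "jp_a \<alpha> \<beta>" "jp_b \<alpha> \<beta>" "jp_alpha \<alpha> \<beta>" "jp_beta \<alpha> \<beta>"
    by (rule jp_real_expansion_jp) (fact lin_indep)
  interpret C: jp_expansion "jp_a \<alpha> \<beta>" "jp_b \<alpha> \<beta>" "jp_conj_alpha \<alpha> \<beta> \<alpha>' \<beta>'" "jp_conj_beta \<alpha> \<beta> \<alpha>' \<beta>'"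
    by standard (rule defined, simp_all)
  have Delta: "jp_Delta \<alpha> \<beta> n = R.errD (n + 2)" "jp_Delta' \<alpha> \<beta> n = R.errE (n + 2)" for n
    by (simp_all add: jp_Delta_def jp_Delta'_def R.errD_def R.errE_def R.den_def
        jp_p_def jp_q_def jp_r_def nat_add_distrib)
  have err_nz: "R.errD (n + 2) \<noteq> 0" "R.errE (n + 2) \<noteq> 0" for n
  proof -
    define r where "r = R.den (n + 2)"
    have r: "r \<noteq> 0" using R.den_pos[of n] by (simp add: r_def)
    define p q where "p = jp_rec (jp_a \<alpha> \<beta>) (jp_b \<alpha> \<beta>) 1 0 (jp_a \<alpha> \<beta> 0) (n + 2)"
      and "q = jp_rec (jp_a \<alpha> \<beta>) (jp_b \<alpha> \<beta>) 0 1 (jp_b \<alpha> \<beta> 0) (n + 2)"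
    have "R.errD (n + 2) = of_rat (of_int p) + of_rat (- of_int r) * \<alpha> + of_rat 0 * \<beta>"
      unfolding R.errD_def p_def[symmetric] r_def[symmetric] by (simp add: of_rat_minus)
    then show "R.errD (n + 2) \<noteq> 0"
      using lin_indep[of "of_int p" "- of_int r" 0] r by auto
    have "R.errE (n + 2) = of_rat (of_int q) + of_rat 0 * \<alpha> + of_rat (- of_int r) * \<beta>"
      unfolding R.errE_def q_def[symmetric] r_def[symmetric] by (simp add: of_rat_minus)
    then show "R.errE (n + 2) \<noteq> 0"
      using lin_indep[of "of_int q" 0 "- of_int r"] r by auto
  qed
  have alternating_iff: "(\<forall>n>N. f (n - 1 + 2) * f (n + 2) < 0) \<longleftrightarrow> (\<forall>k\<ge>N + 2. f k * f (Suc k) < 0)"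
    for N and f :: "nat \<Rightarrow> real"
  proof (intro iffI allI impI)
    fix k assume *: "\<forall>n>N. f (n - 1 + 2) * f (n + 2) < 0" and "k \<ge> N + 2"
    then show "f k * f (Suc k) < 0"
      using *[rule_format, of "k - 1"] by (cases k) (auto simp: eval_nat_numeral Suc_diff_Suc)
  next
    fix n assume *: "\<forall>k\<ge>N + 2. f k * f (Suc k) < 0" and "N < n"
    then show "f (n - 1 + 2) * f (n + 2) < 0"
      using *[rule_format, of "n - 1 + 2"] by simp
  qed
  have "\<exists>N. \<forall>n>N. jp_Delta \<alpha> \<beta> (n - 1) * jp_Delta \<alpha> \<beta> n < 0 \<and>
                  jp_Delta' \<alpha> \<beta> (n - 1) * jp_Delta' \<alpha> \<beta> n < 0"
  proof -
    obtain N where N: "\<forall>n\<in>{n. n \<ge> 1 \<and> jp_Delta \<alpha> \<beta> (n - 1) * jp_Delta \<alpha> \<beta> n > 0}. n \<le> N"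
      using \<open>finite {n. n \<ge> 1 \<and> jp_Delta \<alpha> \<beta> (n - 1) * jp_Delta \<alpha> \<beta> n > 0}\<close>
      unfolding finite_nat_set_iff_bounded_le by (elim exE)
    have "\<not> 0 < R.errD (n - 1 + 2) * R.errD (n + 2)" if "N < n" for n
    proof
      assume "0 < R.errD (n - 1 + 2) * R.errD (n + 2)"
      with that have "n \<in> {n. n \<ge> 1 \<and> jp_Delta \<alpha> \<beta> (n - 1) * jp_Delta \<alpha> \<beta> n > 0}"
        unfolding Delta by simp
      with N have "n \<le> N" by (rule bspec)
      with that show False by simp
    qed
    then have "\<forall>n>N. R.errD (n - 1 + 2) * R.errD (n + 2) < 0"
      by (simp only: not_less order_le_less mult_eq_0_iff err_nz) blast
    then have D: "\<And>k. N + 2 \<le> k \<Longrightarrow> R.errD k * R.errD (Suc k) < 0"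
      unfolding alternating_iff[of N R.errD] by blast
    have E: "R.errE k \<noteq> 0" if "N + 2 \<le> k" for k
    proof -
      have "k - 2 + 2 = k" using that by simp
      then show ?thesis using err_nz(2)[of "k - 2"] by (simp only: not_False_eq_True)
    qed
    have "\<exists>k1. \<forall>k\<ge>k1. R.errE k * R.errE (Suc k) < 0"
      by (rule R.errE_eventually_alternating[of "N + 2"]) (fact D, fact E)
    then obtain k1 where k1: "\<forall>k\<ge>k1. R.errE k * R.errE (Suc k) < 0" ..
    have "\<forall>n>max N k1. R.errD (n - 1 + 2) * R.errD (n + 2) < 0"
      unfolding alternating_iff[of _ R.errD] using D by simp
    moreover have "\<forall>n>max N k1. R.errE (n - 1 + 2) * R.errE (n + 2) < 0"
      unfolding alternating_iff[of _ R.errE] using k1 by simp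
    ultimately show ?thesis unfolding Delta by blast
  qed
  moreover have "(\<lambda>n. jp_conj_beta \<alpha> \<beta> \<alpha>' \<beta>' n
                     + of_int (jp_r \<alpha> \<beta> (int n - 2)) / of_int (jp_r \<alpha> \<beta> (int n - 1))
                         * jp_conj_alpha \<alpha> \<beta> \<alpha>' \<beta>' n
                     + of_int (jp_r \<alpha> \<beta> (int n - 3)) / of_int (jp_r \<alpha> \<beta> (int n - 1)))
                \<longlonglongrightarrow> 0" (is "?f \<longlonglongrightarrow> 0")
    if N: "\<forall>n>N. jp_Delta \<alpha> \<beta> (n - 1) * jp_Delta \<alpha> \<beta> n < 0 \<and>
                jp_Delta' \<alpha> \<beta> (n - 1) * jp_Delta' \<alpha> \<beta> n < 0"
      and sign: "jp_Delta \<alpha> \<beta> N * jp_Delta' \<alpha> \<beta> N * Im \<alpha>' * Im \<beta>' < 0" for N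
  proof -
    have D: "\<And>k. N + 2 \<le> k \<Longrightarrow> R.errD k * R.errD (Suc k) < 0"
      and E: "\<And>k. N + 2 \<le> k \<Longrightarrow> R.errE k * R.errE (Suc k) < 0"
      using N alternating_iff[of N R.errD] alternating_iff[of N R.errE] unfolding Delta by blast+
    have "R.errD (N + 2) * R.errE (N + 2)
        * (Im (jp_conj_alpha \<alpha> \<beta> \<alpha>' \<beta>' 0) * Im (jp_conj_beta \<alpha> \<beta> \<alpha>' \<beta>' 0)) < 0"
      using sign unfolding Delta by (simp add: mult.assoc)
    from conjugate_form_bounded[where ?k0.0 = "N + 2", OF R.jp_real_expansion_axioms C.jp_expansion_axioms D E this]
    obtain M where M: "\<And>n. N + 2 + 2 \<le> n \<Longrightarrow> norm (C.form (\<lambda>k. of_int (R.den k)) n) \<le> M"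
      by blast
    \<comment> \<open>The form with argument \<open>n\<close> belongs to the complete quotients of index \<open>n + 1\<close>.\<close>
    have f_Suc: "?f (Suc n) = C.form (\<lambda>k. of_int (R.den k)) n / of_int (R.den (Suc (Suc n)))" for n
    proof -
      have r: "jp_r \<alpha> \<beta> (int (Suc n) - 1) = R.den (Suc (Suc n))"
        "jp_r \<alpha> \<beta> (int (Suc n) - 2) = R.den (Suc n)"
        "jp_r \<alpha> \<beta> (int (Suc n) - 3) = R.den n"
        by (simp_all add: jp_r_def R.den_def nat_add_distrib eval_nat_numeral)
      have "complex_of_int (R.den (Suc (Suc n))) \<noteq> 0"
        using R.den_pos[of n] by simp
      then show ?thesis
        unfolding r C.form_def by (simp add: field_simps del: jp_conj_alpha.simps jp_conj_beta.simps)
    qed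
    have "(\<lambda>n. ?f (Suc n)) \<longlonglongrightarrow> 0"
    proof (rule Lim_null_comparison)
      show "(\<lambda>n. M / real_of_int (R.den (Suc (Suc n)))) \<longlonglongrightarrow> 0"
        by (rule real_tendsto_divide_at_top[OF tendsto_const R.filterlim_den])
      show "\<forall>\<^sub>F n in sequentially. norm (?f (Suc n)) \<le> M / real_of_int (R.den (Suc (Suc n)))"
      proof (rule eventually_sequentiallyI)
        fix n assume n: "N + 2 + 2 \<le> n"
        have "norm (?f (Suc n))
            = norm (C.form (\<lambda>k. of_int (R.den k)) n) / real_of_int (R.den (Suc (Suc n)))"
          unfolding f_Suc using R.den_pos[of n] by (simp add: norm_divide)
        also have "\<dots> \<le> M / real_of_int (R.den (Suc (Suc n)))"
          using M[OF n] R.den_pos[of n] by (intro divide_right_mono) simp_all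
        finally show "norm (?f (Suc n)) \<le> M / real_of_int (R.den (Suc (Suc n)))" .
      qed
    qed
    then show ?thesis by (rule LIMSEQ_imp_Suc)
  qed
  ultimately show ?thesis by blast
qed

end
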